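(* Let $h:\mathbb{R}^n\to\mathbb{R}$ be convex and absolutely homogeneous, let $g:\mathbb{R}^n\to\mathbb{R}$ be smooth, let $f(\boldsymbol{x})=g(\boldsymbol{x})+h(\boldsymbol{x})$, and let $\boldsymbol{x}_k\in\mathcal{S}$. Let $0<t'<1/h(\boldsymbol{x}_k)$ be a proxy step-size, and let $t$ and $\boldsymbol{v}_k$ be given by $$\boldsymbol{z}=\mathrm{prox}_{|t'|h}\left(\boldsymbol{x}_k-t'\,\mathrm{grad}\,g|_{\boldsymbol{x}_k}\right),\qquad t=\frac{1}{\boldsymbol{x}_k^{\mathsf T}\boldsymbol{z}}\,t',\qquad \boldsymbol{v}_k=\frac{1}{\boldsymbol{x}_k^{\mathsf T}\boldsymbol{z}}\,\boldsymbol{z}-\boldsymbol{x}_k .$$ Set $\boldsymbol{x}_{k+1}=\mathcal{R}_{\boldsymbol{x}_k}(\boldsymbol{v}_k)$. If the line-search criterion $$g\left(\mathcal{R}_{\boldsymbol{x}_k}(\boldsymbol{v}_k)\right)\le g(\boldsymbol{x}_k)+\langle\mathrm{grad}\,g|_{\boldsymbol{x}_k},\boldsymbol{v}_k\rangle+\frac{1}{2t}\langle\boldsymbol{v}_k,\boldsymbol{v}_k\rangle$$ holds, then $$f(\boldsymbol{x}_{k+1})=f\left(\mathcal{R}_{\boldsymbol{x}_k}(\boldsymbol{v}_k)\right)\le f(\boldsymbol{x}_k)-\frac{1}{2t}\langle\boldsymbol{v}_k,\boldsymbol{v}_k\rangle .$$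
   Context: $\mathcal{S}=\{\boldsymbol{x}\in\mathbb{R}^n:\|\boldsymbol{x}\|_2=1\}$ is the unit sphere, with tangent space $\mathcal{T}_{\boldsymbol{x}}\mathcal{S}=\{\boldsymbol{v}:\boldsymbol{x}^{\mathsf T}\boldsymbol{v}=0\}$, Riemannian gradient $\mathrm{grad}\,g|_{\boldsymbol{x}}=(\boldsymbol{I}-\boldsymbol{x}\boldsymbol{x}^{\mathsf T})\nabla g|_{\boldsymbol{x}}$ ($\nabla g$ the Euclidean gradient), and retraction $\mathcal{R}_{\boldsymbol{x}}(\boldsymbol{v})=(\boldsymbol{x}+\boldsymbol{v})/\|\boldsymbol{x}+\boldsymbol{v}\|_2$ for $\boldsymbol{v}\in\mathcal{T}_{\boldsymbol{x}}\mathcal{S}$. A function $h$ is absolutely homogeneous if $h(\alpha\boldsymbol{x})=|\alpha|h(\boldsymbol{x})$ for all scalars $\alpha$ and vectors $\boldsymbol{x}$. For $s\ge 0$, $\mathrm{prox}_{sh}(\boldsymbol{w})=\arg\min_{\boldsymbol{x}}\{s\,h(\boldsymbol{x})+\frac12\|\boldsymbol{x}-\boldsymbol{w}\|_2^2\}$. Convention: $1/h(\boldsymbol{x}_k)=+\infty$ if $h(\boldsymbol{x}_k)=0$. *)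

theory Defs
  imports "HOL-Analysis.Analysis"
begin

text \<open>The vector type \<open>real ^ 'n\<close> is Euclidean n-space with \<open>n = CARD('n)\<close>; its \<open>norm\<close> is the
  2-norm and \<open>\<bullet>\<close> the standard inner product. The unit sphere is \<open>sphere 0 1\<close>.\<close>

definition abs_homogeneous :: "(real ^ 'n \<Rightarrow> real) \<Rightarrow> bool" where
  "abs_homogeneous h \<longleftrightarrow> (\<forall>(a::real) x. h (a *\<^sub>R x) = \<bar>a\<bar> * h x)"

definition euclidean_grad :: "(real ^ 'n \<Rightarrow> real) \<Rightarrow> real ^ 'n \<Rightarrow> real ^ 'n" where
  "euclidean_grad g x = (THE d. GDERIV g x :> d)"

text \<open>Smoothness is read as continuous differentiability, which covers both the reading
  ``infinitely differentiable'' and the reading ``Lipschitz continuous gradient''.\<close>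

definition smooth_fun :: "(real ^ 'n \<Rightarrow> real) \<Rightarrow> bool" where
  "smooth_fun g \<longleftrightarrow> (\<forall>x. g differentiable (at x)) \<and> continuous_on UNIV (euclidean_grad g)"

text \<open>The subtracted matrix is the outer product of \<open>x\<close> with itself.\<close>

definition riemannian_grad :: "(real ^ 'n \<Rightarrow> real) \<Rightarrow> real ^ 'n \<Rightarrow> real ^ 'n" where
  "riemannian_grad g x = (mat 1 - (\<chi> i j. x $ i * x $ j)) *v euclidean_grad g x"

text \<open>The retraction at \<open>x\<close> is meant for tangent \<open>v\<close>, i.e. \<open>x \<bullet> v = 0\<close>.\<close>

definition retraction_at :: "real ^ 'n \<Rightarrow> real ^ 'n \<Rightarrow> real ^ 'n" where
  "retraction_at x v = (1 / norm (x + v)) *\<^sub>R (x + v)"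

text \<open>\<open>prox s h w\<close> is the proximal operator of \<open>s h\<close> at \<open>w\<close>. For convex \<open>h\<close> and \<open>s \<ge> 0\<close> the
  minimizer exists and is unique, so the choice made by \<open>ARG_MIN\<close> is immaterial.\<close>

definition prox :: "real \<Rightarrow> (real ^ 'n \<Rightarrow> real) \<Rightarrow> real ^ 'n \<Rightarrow> real ^ 'n" where
  "prox s h w = (ARG_MIN (\<lambda>x. s * h x + 1 / 2 * (norm (x - w))\<^sup>2) x. True)"

end

theory Submission
  imports Defs
begin

text \<open>For an absolutely homogeneous convex \<open>h\<close> the optimality condition of the proximal step says
  that \<open>u = w - z\<close> (with \<open>w = x - t' grad g\<close>) satisfies \<open>u \<bullet> y \<le> t' h y\<close> for all \<open>y\<close>, with equality
  at \<open>y = z\<close>. Taking \<open>y = x\<close>, where \<open>grad g\<close> is tangent, gives \<open>x \<bullet> z \<ge> 1 - t' h x > 0\<close>. Subtracting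
  the equality at \<open>z = (x \<bullet> z) (x + v)\<close> from the inequality at \<open>x\<close> gives
  \<open>h (x + v) \<le> h x - grad g \<bullet> v - (v \<bullet> v) / t\<close>; the retraction only decreases \<open>h\<close> because
  \<open>norm (x + v) \<ge> 1\<close>. Adding the line-search inequality for \<open>g\<close> yields the claim.\<close>

lemma abs_homogeneousD: "abs_homogeneous h \<Longrightarrow> h (a *\<^sub>R x) = \<bar>a\<bar> * h x"
  by (simp add: abs_homogeneous_def)

lemma abs_homogeneous_zero: "abs_homogeneous h \<Longrightarrow> h 0 = 0"
  using abs_homogeneousD[of h 0 0] by simp

text \<open>The origin is the midpoint of \<open>x\<close> and \<open>- x\<close>, where
  \<open>h\<close> takes the same value, so convexity gives \<open>h 0 \<le> h x\<close>.\<close>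

lemma abs_homogeneous_convex_nonneg:
  assumes "convex_on UNIV h" "abs_homogeneous h"
  shows "0 \<le> h x"
proof -
  have "h ((1 / 2) *\<^sub>R x + (1 / 2) *\<^sub>R (- x)) \<le> 1 / 2 * h x + 1 / 2 * h (- x)"
    using convex_onD[OF assms(1), of "1 / 2" x "- x"] by simp
  moreover have "h (- x) = h x"
    using abs_homogeneousD[OF assms(2), of "-1" x] by simp
  ultimately show ?thesis
    using abs_homogeneous_zero[OF assms(2)] by simp
qed

text \<open>\<open>ARG_MIN\<close> carries information only once a minimizer exists. The objective
  is continuous, so it has a minimum on the ball of radius \<open>norm w\<close> around
  \<open>w\<close>. This ball contains 0, and outside it the quadratic term alone is at least the
  value at 0.\<close>

lemma prox_le:
  fixes h :: "real ^ 'n \<Rightarrow> real"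
  assumes conv: "convex_on UNIV h" and nonneg: "\<And>y. 0 \<le> h y" and zero: "h 0 = 0" and s: "0 \<le> s"
  shows "s * h (prox s h w) + 1 / 2 * (norm (prox s h w - w))\<^sup>2 \<le> s * h y + 1 / 2 * (norm (y - w))\<^sup>2"
proof -
  define F where "F = (\<lambda>y. s * h y + 1 / 2 * (norm (y - w))\<^sup>2)"
  have "continuous_on UNIV h"
    using conv by (intro convex_on_continuous) auto
  then have "continuous_on (cball w (norm w)) F"
    unfolding F_def by (intro continuous_intros) (auto intro: continuous_on_subset)
  then obtain m where m: "\<And>y. y \<in> cball w (norm w) \<Longrightarrow> F m \<le> F y"
    using continuous_attains_inf[of "cball w (norm w)" F]
    by (metis cball_eq_empty compact_cball norm_not_less_zero)
  have "F m \<le> F y" for y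
  proof (cases "y \<in> cball w (norm w)")
    case False
    then have "(norm w)\<^sup>2 \<le> (norm (y - w))\<^sup>2"
      by (intro power_mono) (auto simp: dist_norm norm_minus_commute)
    moreover have "F m \<le> F 0"
      by (intro m) (simp add: dist_norm)
    moreover have "0 \<le> s * h y"
      using s nonneg by simp
    ultimately show ?thesis
      unfolding F_def zero by (simp del: power_mono_iff)
  qed (use m in simp)
  then have "is_arg_min F (\<lambda>_. True) m"
    by (simp add: is_arg_min_linorder)
  then have "is_arg_min F (\<lambda>_. True) (prox s h w)"
    unfolding prox_def arg_min_def F_def[symmetric] by (rule someI)
  then have "F (prox s h w) \<le> F y"
    by (simp add: is_arg_min_linorder)
  then show ?thesis
    by (simp add: F_def)
qed

text \<open>Compare \<open>z\<close> with the points of the segment from \<open>z\<close> to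
  \<open>y\<close>: convexity bounds \<open>h\<close> there, the expanded square has a remainder of
  order \<open>e\<^sup>2\<close>, and dividing by \<open>e\<close> and letting \<open>e\<close> tend
  to 0 leaves the first-order condition.\<close>

lemma prox_variational:
  fixes h :: "'a::real_inner \<Rightarrow> real"
  assumes conv: "convex_on UNIV h" and s: "0 \<le> s"
    and min: "\<And>y. s * h z + 1 / 2 * (norm (z - w))\<^sup>2 \<le> s * h y + 1 / 2 * (norm (y - w))\<^sup>2"
  shows "s * h z + (w - z) \<bullet> (y - z) \<le> s * h y"
proof -
  define D where "D = s * (h y - h z) + (z - w) \<bullet> (y - z)"
  define q where "q = 1 / 2 * (norm (y - z))\<^sup>2"
  have bound: "0 \<le> D + e * q" if e: "0 < e" "e < 1" for e
  proof -
    define p where "p = (1 - e) *\<^sub>R z + e *\<^sub>R y"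
    have "h p \<le> (1 - e) * h z + e * h y"
      unfolding p_def using e by (intro convex_onD[OF conv]) auto
    then have "s * h p \<le> s * ((1 - e) * h z + e * h y)"
      using s by (rule mult_left_mono)
    moreover have "p - w = (z - w) + e *\<^sub>R (y - z)"
      by (simp add: p_def algebra_simps)
    then have "(norm (p - w))\<^sup>2 = (norm (z - w))\<^sup>2 + 2 * e * ((z - w) \<bullet> (y - z)) + e\<^sup>2 * (norm (y - z))\<^sup>2"
      by (simp only: power2_norm_eq_inner inner_add_left inner_add_right inner_scaleR_left
          inner_scaleR_right inner_commute[of "y - z" "z - w"])
        (simp add: power2_eq_square algebra_simps)
    ultimately have "0 \<le> e * (D + e * q)"
      using min[of p] by (simp add: D_def q_def algebra_simps power2_eq_square)
    then show ?thesis
      using e by (simp add: zero_le_mult_iff)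
  qed
  have "((\<lambda>e. D + e * q) \<longlongrightarrow> D + 0 * q) (at_right 0)"
    by (intro tendsto_intros)
  moreover have "eventually (\<lambda>e. 0 \<le> D + e * q) (at_right 0)"
    unfolding eventually_at_right_field using bound by (intro exI[of _ 1]) auto
  ultimately have "0 \<le> D"
    using tendsto_lowerbound[of "\<lambda>e. D + e * q" "D + 0 * q" "at_right 0" 0] by simp
  then show ?thesis
    by (simp add: D_def algebra_simps inner_diff_left)
qed

lemma outer_product_mult: "(\<chi> i j. (x $ i * x $ j :: real)) *v d = (x \<bullet> d) *\<^sub>R x"
  by (simp add: vec_eq_iff matrix_vector_mult_def inner_vec_def sum_distrib_left sum_distrib_right
      mult_ac)

lemma riemannian_grad_tangent:
  assumes "norm x = 1"
  shows "x \<bullet> riemannian_grad g x = 0"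
proof -
  have "x \<bullet> x = 1"
    using assms by (simp add: norm_eq_1)
  then show ?thesis
    by (simp add: riemannian_grad_def matrix_vector_mult_diff_rdistrib outer_product_mult
        inner_diff_right)
qed

theorem theorem2:
  fixes g h f :: "real ^ 'n \<Rightarrow> real"
    and x z v x_next :: "real ^ 'n"
    and t' t :: real
  assumes "convex_on UNIV h"
    and "abs_homogeneous h"
    and "smooth_fun g"
    and "f = (\<lambda>y. g y + h y)"
    and "x \<in> sphere 0 1"
    and "0 < t'"
    and "ereal t' < 1 / ereal (h x)"
    and "z = prox \<bar>t'\<bar> h (x - t' *\<^sub>R riemannian_grad g x)"
    and "t = 1 / (x \<bullet> z) * t'"
    and "v = (1 / (x \<bullet> z)) *\<^sub>R z - x"
    and "x_next = retraction_at x v"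
    and "g (retraction_at x v) \<le> g x + riemannian_grad g x \<bullet> v + 1 / (2 * t) * (v \<bullet> v)"
  shows "f x_next = f (retraction_at x v)
       \<and> f (retraction_at x v) \<le> f x - 1 / (2 * t) * (v \<bullet> v)"
proof -
  define r where "r = riemannian_grad g x"
  define u where "u = x - t' *\<^sub>R r - z"
  define c where "c = x \<bullet> z"
  note hom = abs_homogeneousD[OF assms(2)]
  note zero = abs_homogeneous_zero[OF assms(2)]
  note nonneg = abs_homogeneous_convex_nonneg[OF assms(1,2)]
  have x: "x \<bullet> x = 1" "norm x = 1"
    using assms(5) by (auto simp: norm_eq_1)
  have xr: "x \<bullet> r = 0"
    unfolding r_def using x by (intro riemannian_grad_tangent)
  have z: "z = prox t' h (x - t' *\<^sub>R r)"
    using assms(6,8) by (simp add: r_def)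
  have var: "t' * h z + u \<bullet> (y - z) \<le> t' * h y" for y
    unfolding u_def using assms(1,6) prox_le[OF assms(1) nonneg zero, of t' "x - t' *\<^sub>R r"]
    by (intro prox_variational) (auto simp: z)
  \<comment> \<open>Moving along the ray through \<open>z\<close> in both directions, to 0 and to
    \<open>2 *\<^sub>R z\<close>, gives the two opposite inequalities.\<close>
  have uz: "t' * h z = u \<bullet> z"
    using var[of 0] var[of "2 *\<^sub>R z"] zero hom[of 2 z] by (simp add: inner_diff_right)
  \<comment> \<open>Since \<open>x\<close> is a unit vector orthogonal to \<open>r\<close>, the left
    side is \<open>u \<bullet> x\<close>.\<close>
  have ux: "1 - c \<le> t' * h x"
    using var[of x] uz x xr
    by (simp add: u_def c_def inner_diff_left inner_diff_right inner_commute)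
  \<comment> \<open>If \<open>h x = 0\<close>, the step-size bound is infinite, but the product
    vanishes.\<close>
  have "t' * h x < 1"
  proof (cases "h x = 0")
    case False
    then have "0 < h x"
      using nonneg[of x] by simp
    then show ?thesis
      using assms(7) by (simp add: one_ereal_def field_simps)
  qed simp
  then have c: "0 < c"
    using ux by simp
  have zc: "z = c *\<^sub>R (x + v)"
    using c by (simp add: assms(10) c_def)
  have t: "t' = c * t" "0 < t"
    using c assms(6) by (auto simp: assms(9) c_def)
  have xv: "x \<bullet> v = 0"
    using c x by (simp add: assms(10) c_def inner_diff_right)
  have hz: "h z = c * h (x + v)"
    using c by (simp add: zc hom)
  have "u \<bullet> z = c * (1 - t' * (r \<bullet> v) - c * (1 + v \<bullet> v))"
    unfolding u_def zc
    using x xr xv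
    by (simp add: inner_diff_left inner_add_left inner_add_right inner_commute algebra_simps)
  \<comment> \<open>Both sides of \<open>uz\<close> contain a factor \<open>c\<close>, which is
    cancelled here; \<open>ux\<close> then bounds the remaining \<open>1 - c\<close> by
    \<open>c * t * h x\<close>.\<close>
  then have "c * (t * h (x + v)) = 1 - c * t * (r \<bullet> v) - c * (1 + v \<bullet> v)"
    using uz hz t c by (simp add: mult_ac)
  then have "c * (t * h (x + v)) \<le> c * (t * h x - t * (r \<bullet> v) - v \<bullet> v)"
    using ux t by (simp add: algebra_simps)
  then have "t * h (x + v) \<le> t * h x - t * (r \<bullet> v) - v \<bullet> v"
    using c by simp
  then have h_step: "h (x + v) \<le> h x - r \<bullet> v - (v \<bullet> v) / t"
    using t by (simp add: field_simps)
  \<comment> \<open>Pythagoras: \<open>v\<close> is tangent at the unit vector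
    \<open>x\<close>.\<close>
  have "1 \<le> (norm (x + v))\<^sup>2"
    using x xv by (simp add: power2_norm_eq_inner inner_add_left inner_add_right inner_commute)
  then have "1 \<le> norm (x + v)"
    using power2_le_imp_le[of 1 "norm (x + v)"] by simp
  then have "h (retraction_at x v) \<le> h (x + v)"
    using nonneg[of "x + v"] mult_left_mono[of 1 "norm (x + v)" "h (x + v)"]
    by (simp add: retraction_at_def hom zero divide_simps)
  moreover have "1 / (2 * t) * (v \<bullet> v) = (v \<bullet> v) / t / 2"
    by simp
  ultimately have "f (retraction_at x v) \<le> f x - 1 / (2 * t) * (v \<bullet> v)"
    using h_step assms(12) unfolding assms(4) r_def by linarith
  with assms(11) show ?thesis
    by simp
qed

end
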